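(* Let $G$ be a discrete group acting on a von Neumann algebra $\mathcal{M}\subseteq B(\mathcal{H})$ by $*$-automorphisms $\alpha_g$, $g\in G$, and let $H$ and $K$ be two distinct subgroups of $G$. Then, in $\mathcal{M}\rtimes_\alpha G$, $$d_{KK}(\mathcal{M}\rtimes_\alpha H,\ \mathcal{M}\rtimes_\alpha K)=1=d_0(\mathcal{M}\rtimes_\alpha H,\ \mathcal{M}\rtimes_\alpha K).$$
   Context: Distances. For a normed space $\mathcal{V}$, $B_1(\mathcal{V})$ is its closed unit ball and $d(v,S)=\inf\{\|v-s\| : s\in S\}$. For subspaces $\mathcal{Y},\mathcal{Z}$ of $\mathcal{V}$, the Kadison-Kastler distance is $$d_{KK}(\mathcal{Y},\mathcal{Z})=\max\left\{\sup_{y\in B_1(\mathcal{Y})} d(y,B_1(\mathcal{Z})),\ \sup_{z\in B_1(\mathcal{Z})} d(z,B_1(\mathcal{Y}))\right\}.$$ For $\gamma>0$ write $\mathcal{Y}\subseteq_{\gamma}\mathcal{Z}$ if for each $y\in B_1(\mathcal{Y})$ there is $z\in\mathcal{Z}$ with $\|y-z\|\le\gamma$; the Christensen distance is $d_0(\mathcal{Y},\mathcal{Z})=\inf\{\gamma>0 : \mathcal{Y}\subseteq_{\gamma}\mathcal{Z}\text{ and }\mathcal{Z}\subseteq_{\gamma}\mathcal{Y}\}$. Crossed product. On $\tilde{\mathcal{H}}=\ell^2(G,\mathcal{H})$ define, for $a\in\mathcal{M}$, $g,h\in G$, $\xi\in\tilde{\mathcal{H}}$, $$(\pi(a)\xi)(g)=\alpha_{g^{-1}}(a)\xi(g),\qquad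 (\lambda(g)\xi)(h)=\xi(g^{-1}h).$$ Then $\lambda(g)\pi(a)\lambda(g)^*=\pi(\alpha_g(a))$. $\mathcal{M}\rtimes_\alpha G$ is the von Neumann algebra generated by $\pi(\mathcal{M})$ and $\lambda(G)$ in $B(\tilde{\mathcal{H}})$. For a subgroup $H\le G$, $\mathcal{M}\rtimes_\alpha H$ denotes the von Neumann subalgebra of $\mathcal{M}\rtimes_\alpha G$ generated by $\pi(\mathcal{M})$ and $\lambda(H)$. The von Neumann algebra $\mathcal{M}$ is understood to be nonzero. *)

theory Defs
  imports "HOL-Analysis.Analysis"
begin

section \<open>Complex Hilbert spaces\<close>

text \<open>The inner product is linear in the first argument.  Positivity and definiteness of \<open>cinner\<close>
  are consequences of the norm axioms and \<open>cinner_self\<close>; completeness comes from class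
  \<^class>\<open>banach\<close>.\<close>

class chilbert_space = banach +
  fixes scaleC :: "complex \<Rightarrow> 'a \<Rightarrow> 'a"  (infixr \<open>*\<^sub>C\<close> 75)
    and cinner :: "'a \<Rightarrow> 'a \<Rightarrow> complex"
  assumes scaleC_add_right: "c *\<^sub>C (x + y) = c *\<^sub>C x + c *\<^sub>C y"
    and scaleC_add_left: "(c + d) *\<^sub>C x = c *\<^sub>C x + d *\<^sub>C x"
    and scaleC_scaleC: "c *\<^sub>C d *\<^sub>C x = (c * d) *\<^sub>C x"
    and scaleR_scaleC: "r *\<^sub>R x = complex_of_real r *\<^sub>C x"
    and cinner_commute: "cinner x y = cnj (cinner y x)"
    and cinner_add_left: "cinner (x + y) z = cinner x z + cinner y z"
    and cinner_scaleC_left: "cinner (c *\<^sub>C x) y = c * cinner x y"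
    and cinner_self: "cinner x x = complex_of_real ((norm x)\<^sup>2)"

lemma cinner_scaleC_right:
  fixes x y :: "'a::chilbert_space"
  shows "cinner x (c *\<^sub>C y) = cnj c * cinner x y"
  by (metis cinner_commute cinner_scaleC_left complex_cnj_mult)

lemma cinner_add_right:
  fixes x y z :: "'a::chilbert_space"
  shows "cinner x (y + z) = cinner x y + cinner x z"
  by (metis cinner_add_left cinner_commute complex_cnj_add)

lemma norm_scaleC:
  fixes x :: "'a::chilbert_space"
  shows "norm (c *\<^sub>C x) = cmod c * norm x"
proof -
  have "complex_of_real ((norm (c *\<^sub>C x))\<^sup>2) = c * cnj c * complex_of_real ((norm x)\<^sup>2)"
    by (simp only: cinner_self[symmetric] cinner_scaleC_left cinner_scaleC_right mult_ac)
  also have "\<dots> = complex_of_real ((cmod c * norm x)\<^sup>2)"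
    by (simp only: complex_norm_square[symmetric] of_real_mult of_real_power power_mult_distrib)
  finally have "(norm (c *\<^sub>C x))\<^sup>2 = (cmod c * norm x)\<^sup>2"
    using of_real_eq_iff by blast
  then show ?thesis
    by simp
qed

lemma Re_cinner_le:
  fixes x y :: "'a::chilbert_space"
  shows "Re (cinner x y) \<le> norm x * norm y"
proof -
  have "complex_of_real ((norm (x + y))\<^sup>2)
      = complex_of_real ((norm x)\<^sup>2) + complex_of_real ((norm y)\<^sup>2) + (cinner x y + cnj (cinner x y))"
    unfolding cinner_self[symmetric] using cinner_commute[of y x]
    by (simp add: cinner_add_left cinner_add_right)
  also have "\<dots> = complex_of_real ((norm x)\<^sup>2 + (norm y)\<^sup>2 + 2 * Re (cinner x y))"
    by (simp add: complex_eq_iff)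
  finally have "(norm (x + y))\<^sup>2 = (norm x)\<^sup>2 + (norm y)\<^sup>2 + 2 * Re (cinner x y)"
    using of_real_eq_iff by blast
  moreover have "(norm (x + y))\<^sup>2 \<le> (norm x + norm y)\<^sup>2"
    by (intro power_mono norm_triangle_ineq) auto
  ultimately show ?thesis
    by (simp add: power2_sum)
qed

lemma norm_cinner_le:
  fixes x y :: "'a::chilbert_space"
  shows "cmod (cinner x y) \<le> norm x * norm y"
proof (cases "cinner x y = 0")
  case False
  define c where "c = cnj (cinner x y) / complex_of_real (cmod (cinner x y))"
  have c: "cmod c = 1"
    using False by (simp add: c_def norm_divide)
  have "cinner (c *\<^sub>C x) y = complex_of_real (cmod (cinner x y))"
    using False
    by (simp add: c_def cinner_scaleC_left complex_norm_square[symmetric] power2_eq_square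
        mult.commute[of "cnj _"] divide_simps)
  then have "cmod (cinner x y) = Re (cinner (c *\<^sub>C x) y)"
    by simp
  also have "\<dots> \<le> norm x * norm y"
    using Re_cinner_le[of "c *\<^sub>C x" y] by (simp add: norm_scaleC c)
  finally show ?thesis .
qed auto


section \<open>The Hilbert space of square-summable functions\<close>

typedef (overloaded) ('g, 'h::chilbert_space) ell2 =
  "{f :: 'g \<Rightarrow> 'h. (\<lambda>g. (norm (f g))\<^sup>2) summable_on UNIV}"
  morphisms ell2_apply Abs_ell2
  by (rule exI[of _ "\<lambda>_. 0"]) simp

setup_lifting type_definition_ell2

lemma ell2I:
  assumes "\<And>F. finite F \<Longrightarrow> L2_set (\<lambda>g. norm (f g)) F \<le> c"
  shows "(\<lambda>g. (norm (f g))\<^sup>2) summable_on UNIV"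
    and "sqrt (\<Sum>\<^sub>\<infinity>g. (norm (f g))\<^sup>2) \<le> c"
proof -
  have c: "0 \<le> c"
    using assms[of "{}"] by simp
  have le: "(\<Sum>g\<in>F. (norm (f g))\<^sup>2) \<le> c\<^sup>2" if "finite F" for F
    using assms[OF that] c by (simp add: L2_set_def sqrt_le_D)
  show s: "(\<lambda>g. (norm (f g))\<^sup>2) summable_on UNIV"
    by (rule nonneg_bdd_above_summable_on) (auto intro!: bdd_aboveI2[where M = "c\<^sup>2"] le)
  have "(\<Sum>\<^sub>\<infinity>g. (norm (f g))\<^sup>2) \<le> c\<^sup>2"
    by (rule infsum_le_finite_sums[OF s]) (rule le)
  then show "sqrt (\<Sum>\<^sub>\<infinity>g. (norm (f g))\<^sup>2) \<le> c"
    using c real_le_lsqrt by (simp add: infsum_nonneg)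
qed

lemma L2_set_le_ell2:
  assumes "(\<lambda>g. (norm (f g))\<^sup>2) summable_on UNIV" "finite F"
  shows "L2_set (\<lambda>g. norm (f g)) F \<le> sqrt (\<Sum>\<^sub>\<infinity>g. (norm (f g))\<^sup>2)"
  unfolding L2_set_def using assms by (auto intro!: finite_sum_le_infsum)

lemma ell2_add_aux:
  assumes f: "(\<lambda>g. (norm (f g))\<^sup>2) summable_on UNIV" and h: "(\<lambda>g. (norm (h g))\<^sup>2) summable_on UNIV"
    and F: "finite F"
  shows "L2_set (\<lambda>g. norm (f g + h g)) F
    \<le> sqrt (\<Sum>\<^sub>\<infinity>g. (norm (f g))\<^sup>2) + sqrt (\<Sum>\<^sub>\<infinity>g. (norm (h g))\<^sup>2)"
proof -
  have "L2_set (\<lambda>g. norm (f g + h g)) F \<le> L2_set (\<lambda>g. norm (f g) + norm (h g)) F"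
    by (intro L2_set_mono norm_triangle_ineq) auto
  also have "\<dots> \<le> L2_set (\<lambda>g. norm (f g)) F + L2_set (\<lambda>g. norm (h g)) F"
    by (rule L2_set_triangle_ineq)
  also have "\<dots> \<le> sqrt (\<Sum>\<^sub>\<infinity>g. (norm (f g))\<^sup>2) + sqrt (\<Sum>\<^sub>\<infinity>g. (norm (h g))\<^sup>2)"
    by (intro add_mono L2_set_le_ell2 f h F)
  finally show ?thesis .
qed

instantiation ell2 :: (type, chilbert_space) real_normed_vector
begin

lift_definition zero_ell2 :: "('a, 'b) ell2" is "\<lambda>_. 0"
  by simp

lift_definition plus_ell2 :: "('a, 'b) ell2 \<Rightarrow> ('a, 'b) ell2 \<Rightarrow> ('a, 'b) ell2"
  is "\<lambda>f h g. f g + h g"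
  by (rule ell2I(1)[OF ell2_add_aux])

lift_definition uminus_ell2 :: "('a, 'b) ell2 \<Rightarrow> ('a, 'b) ell2" is "\<lambda>f g. - f g"
  by simp

lift_definition minus_ell2 :: "('a, 'b) ell2 \<Rightarrow> ('a, 'b) ell2 \<Rightarrow> ('a, 'b) ell2"
  is "\<lambda>f h g. f g - h g"
  subgoal for f h
    using ell2I(1)[OF ell2_add_aux, of f "\<lambda>g. - h g"] by simp
  done

lift_definition scaleR_ell2 :: "real \<Rightarrow> ('a, 'b) ell2 \<Rightarrow> ('a, 'b) ell2" is "\<lambda>r f g. r *\<^sub>R f g"
  by (simp add: power_mult_distrib summable_on_cmult_right)

lift_definition norm_ell2 :: "('a, 'b) ell2 \<Rightarrow> real" is "\<lambda>f. sqrt (\<Sum>\<^sub>\<infinity>g. (norm (f g))\<^sup>2)" .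

definition dist_ell2 :: "('a, 'b) ell2 \<Rightarrow> ('a, 'b) ell2 \<Rightarrow> real"
  where "dist_ell2 x y = norm (x - y)"

definition sgn_ell2 :: "('a, 'b) ell2 \<Rightarrow> ('a, 'b) ell2"
  where "sgn_ell2 x = inverse (norm x) *\<^sub>R x"

definition uniformity_ell2 :: "(('a, 'b) ell2 \<times> ('a, 'b) ell2) filter"
  where "uniformity_ell2 = (INF e\<in>{0 <..}. principal {(x, y). dist x y < e})"

definition open_ell2 :: "('a, 'b) ell2 set \<Rightarrow> bool"
  where "open_ell2 S = (\<forall>x\<in>S. \<forall>\<^sub>F (x', y) in uniformity. x' = x \<longrightarrow> y \<in> S)"

instance
proof
  fix x y z :: "('a, 'b) ell2" and r s :: real
  show "x + y + z = x + (y + z)" "x + y = y + x" "0 + x = x" "- x + x = 0" "x - y = x + - y"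
    "r *\<^sub>R (x + y) = r *\<^sub>R x + r *\<^sub>R y" "(r + s) *\<^sub>R x = r *\<^sub>R x + s *\<^sub>R x"
    "r *\<^sub>R s *\<^sub>R x = (r * s) *\<^sub>R x" "1 *\<^sub>R x = x"
    by (transfer; simp add: algebra_simps fun_eq_iff)+
  show "dist x y = norm (x - y)"
    by (rule dist_ell2_def)
  show "sgn x = inverse (norm x) *\<^sub>R x"
    by (rule sgn_ell2_def)
  show "uniformity = (INF e\<in>{0 <..}. principal {(x :: ('a, 'b) ell2, y). dist x y < e})"
    by (rule uniformity_ell2_def)
  show "open S = (\<forall>x\<in>S. \<forall>\<^sub>F (x', y) in uniformity. x' = x \<longrightarrow> y \<in> S)" for S :: "('a, 'b) ell2 set"
    by (rule open_ell2_def)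
  show "(norm x = 0) = (x = 0)"
  proof (transfer, safe)
    fix f :: "'a \<Rightarrow> 'b"
    assume f: "(\<lambda>g. (norm (f g))\<^sup>2) summable_on UNIV" and "sqrt (\<Sum>\<^sub>\<infinity>g. (norm (f g))\<^sup>2) = 0"
    then have "norm (f g) \<le> 0" for g
      using L2_set_le_ell2[OF f, of "{g}"] by simp
    then show "f = (\<lambda>_. 0)"
      by (auto simp: fun_eq_iff)
  qed simp
  show "norm (x + y) \<le> norm x + norm y"
    by transfer (rule ell2I(2)[OF ell2_add_aux])
  show "norm (r *\<^sub>R x) = \<bar>r\<bar> * norm x"
    by transfer (simp add: power_mult_distrib infsum_cmult_right' real_sqrt_mult)
qed

end

lemma norm_ell2_apply_le: "norm (ell2_apply \<xi> g) \<le> norm \<xi>"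
  by transfer (use L2_set_le_ell2[of _ "{_}"] in simp)

lemma ell2_complete:
  fixes X :: "nat \<Rightarrow> ('g, 'h::chilbert_space) ell2"
  assumes X: "Cauchy X"
  shows "convergent X"
proof -
  have Cg: "Cauchy (\<lambda>n. ell2_apply (X n) g)" for g
  proof (rule CauchyI)
    fix e :: real assume "0 < e"
    then obtain M where M: "\<And>m n. m \<ge> M \<Longrightarrow> n \<ge> M \<Longrightarrow> norm (X m - X n) < e"
      using CauchyD[OF X] by blast
    have "norm (ell2_apply (X m) g - ell2_apply (X n) g) < e" if "m \<ge> M" "n \<ge> M" for m n
      using norm_ell2_apply_le[of "X m - X n" g] M[OF that] by (simp add: minus_ell2.rep_eq)
    then show "\<exists>M. \<forall>m\<ge>M. \<forall>n\<ge>M. norm (ell2_apply (X m) g - ell2_apply (X n) g) < e"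
      by blast
  qed
  define L where "L g = lim (\<lambda>n. ell2_apply (X n) g)" for g
  have L: "(\<lambda>n. ell2_apply (X n) g) \<longlonglongrightarrow> L g" for g
    unfolding L_def by (rule convergent_LIMSEQ_iff[THEN iffD1, OF Cauchy_convergent[OF Cg]])
  have tail: "\<exists>N. \<forall>n\<ge>N. \<forall>F. finite F \<longrightarrow>
      L2_set (\<lambda>g. norm (ell2_apply (X n) g - L g)) F \<le> e" if "0 < e" for e
  proof -
    obtain N where N: "\<And>m n. m \<ge> N \<Longrightarrow> n \<ge> N \<Longrightarrow> norm (X m - X n) < e"
      using CauchyD[OF X \<open>0 < e\<close>] by blast
    have "L2_set (\<lambda>g. norm (ell2_apply (X n) g - L g)) F \<le> e" if "n \<ge> N" "finite F" for n F
    proof (rule LIMSEQ_le_const2)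
      show "(\<lambda>m. L2_set (\<lambda>g. norm (ell2_apply (X n) g - ell2_apply (X m) g)) F)
          \<longlonglongrightarrow> L2_set (\<lambda>g. norm (ell2_apply (X n) g - L g)) F"
        unfolding L2_set_def by (intro tendsto_intros L)
      have "L2_set (\<lambda>g. norm (ell2_apply (X n) g - ell2_apply (X m) g)) F \<le> norm (X n - X m)" for m
        using L2_set_le_ell2[OF ell2_apply[of "X n - X m", simplified] that(2)]
        by (simp add: norm_ell2.rep_eq minus_ell2.rep_eq)
      then show "\<exists>M. \<forall>m\<ge>M. L2_set (\<lambda>g. norm (ell2_apply (X n) g - ell2_apply (X m) g)) F \<le> e"
        using N[OF that(1)] by (intro exI[of _ N] allI impI) (rule order_trans[OF _ less_imp_le])
    qed
    then show ?thesis
      by blast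
  qed
  obtain N where N: "\<And>F. finite F \<Longrightarrow> L2_set (\<lambda>g. norm (ell2_apply (X N) g - L g)) F \<le> 1"
    using tail[of 1] by auto
  define D where "D = Abs_ell2 (\<lambda>g. ell2_apply (X N) g - L g)"
  have D: "ell2_apply D g = ell2_apply (X N) g - L g" for g
    unfolding D_def using ell2I(1)[OF N] by (subst Abs_ell2_inverse) auto
  have lim: "ell2_apply (X N - D) g = L g" for g
    by (simp add: minus_ell2.rep_eq D)
  have "X \<longlonglongrightarrow> X N - D"
  proof (rule LIMSEQ_I)
    fix e :: real assume "0 < e"
    then obtain K where K: "\<And>n F. n \<ge> K \<Longrightarrow> finite F \<Longrightarrow>
        L2_set (\<lambda>g. norm (ell2_apply (X n) g - L g)) F \<le> e / 2"
      using tail[of "e / 2"] by auto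
    have "norm (X n - (X N - D)) < e" if "n \<ge> K" for n
    proof -
      have "norm (X n - (X N - D)) \<le> e / 2"
        unfolding norm_ell2.rep_eq
        by (rule ell2I(2)) (use K[OF that] in \<open>simp add: minus_ell2.rep_eq[of "X n"] lim\<close>)
      then show ?thesis
        using \<open>0 < e\<close> by simp
    qed
    then show "\<exists>K. \<forall>n\<ge>K. norm (X n - (X N - D)) < e"
      by blast
  qed
  then show ?thesis
    by (rule convergentI)
qed

lemma cinner_summable:
  assumes f: "(\<lambda>g. (norm (f g))\<^sup>2) summable_on UNIV" and h: "(\<lambda>g. (norm (h g))\<^sup>2) summable_on UNIV"
  shows "(\<lambda>g. cinner (f g) (h g)) summable_on UNIV"
proof (rule Infinite_Sum.abs_summable_summable, rule Infinite_Sum.abs_summable_on_comparison_test')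
  show "(\<lambda>g. (norm (f g))\<^sup>2 + (norm (h g))\<^sup>2) summable_on UNIV"
    by (intro summable_on_add f h)
  show "norm (cinner (f g) (h g)) \<le> (norm (f g))\<^sup>2 + (norm (h g))\<^sup>2" for g
  proof -
    have "norm (cinner (f g) (h g)) \<le> norm (f g) * norm (h g)"
      by (rule norm_cinner_le)
    also have "\<dots> \<le> 2 * (norm (f g) * norm (h g))"
      by simp
    also have "\<dots> \<le> (norm (f g))\<^sup>2 + (norm (h g))\<^sup>2"
      using sum_squares_bound[of "norm (f g)" "norm (h g)"] by simp
    finally show ?thesis .
  qed
qed

instantiation ell2 :: (type, chilbert_space) chilbert_space
begin

lift_definition scaleC_ell2 :: "complex \<Rightarrow> ('a, 'b) ell2 \<Rightarrow> ('a, 'b) ell2" is "\<lambda>c f g. c *\<^sub>C f g"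
  by (simp add: norm_scaleC power_mult_distrib summable_on_cmult_right)

lift_definition cinner_ell2 :: "('a, 'b) ell2 \<Rightarrow> ('a, 'b) ell2 \<Rightarrow> complex"
  is "\<lambda>f h. \<Sum>\<^sub>\<infinity>g. cinner (f g) (h g)" .

instance
proof
  fix x y z :: "('a, 'b) ell2" and c d :: complex and r :: real
  show "convergent X" if "Cauchy X" for X :: "nat \<Rightarrow> ('a, 'b) ell2"
    using that by (rule ell2_complete)
  show "c *\<^sub>C (x + y) = c *\<^sub>C x + c *\<^sub>C y"
    by transfer (simp add: scaleC_add_right)
  show "(c + d) *\<^sub>C x = c *\<^sub>C x + d *\<^sub>C x"
    by transfer (simp add: scaleC_add_left)
  show "c *\<^sub>C d *\<^sub>C x = (c * d) *\<^sub>C x"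
    by transfer (simp add: scaleC_scaleC)
  show "r *\<^sub>R x = complex_of_real r *\<^sub>C x"
    by transfer (simp add: scaleR_scaleC)
  show "cinner x y = cnj (cinner y x)"
    by transfer (simp add: cinner_commute[symmetric] flip: infsum_cnj)
  show "cinner (x + y) z = cinner x z + cinner y z"
    by transfer (simp add: cinner_add_left infsum_add cinner_summable)
  show "cinner (c *\<^sub>C x) y = c * cinner x y"
    by transfer (simp add: cinner_scaleC_left infsum_cmult_right')
  show "cinner x x = complex_of_real ((norm x)\<^sup>2)"
  proof transfer
    fix f :: "'a \<Rightarrow> 'b"
    assume "(\<lambda>g. (norm (f g))\<^sup>2) summable_on UNIV"
    then have "((\<lambda>g. complex_of_real ((norm (f g))\<^sup>2)) has_sum
        complex_of_real (\<Sum>\<^sub>\<infinity>g. (norm (f g))\<^sup>2)) UNIV"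
      by (intro has_sum_of_real_iff[THEN iffD2] has_sum_infsum)
    then show "(\<Sum>\<^sub>\<infinity>g. cinner (f g) (f g)) = complex_of_real ((sqrt (\<Sum>\<^sub>\<infinity>g. (norm (f g))\<^sup>2))\<^sup>2)"
      unfolding cinner_self by (simp only: infsumI real_sqrt_pow2 infsum_nonneg zero_le_power2)
  qed
qed

end


section \<open>Von Neumann algebras\<close>

text \<open>\<open>B(\<H>)\<close>: the library type of bounded linear operators is real-linear, so complex homogeneity
  is imposed separately; the norm of the library type is the operator norm.\<close>

definition cblinops :: "('h::chilbert_space \<Rightarrow>\<^sub>L 'h) set" where
  "cblinops = {T. \<forall>c x. blinfun_apply T (c *\<^sub>C x) = c *\<^sub>C blinfun_apply T x}"

definition cscale_blinfun :: "complex \<Rightarrow> ('h::chilbert_space \<Rightarrow>\<^sub>L 'h) \<Rightarrow> ('h \<Rightarrow>\<^sub>L 'h)" where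
  "cscale_blinfun c T = Blinfun (\<lambda>x. c *\<^sub>C blinfun_apply T x)"

definition cadjoint :: "('h::chilbert_space \<Rightarrow>\<^sub>L 'h) \<Rightarrow> ('h \<Rightarrow>\<^sub>L 'h)" where
  "cadjoint T = (THE S. \<forall>x y. cinner (blinfun_apply T x) y = cinner x (blinfun_apply S y))"

text \<open>The weak operator topology on \<open>B(\<H>)\<close>: the coarsest topology making all the maps
  \<open>T \<mapsto> \<langle>T x, y\<rangle>\<close> continuous (the topology \<^const>\<open>euclidean\<close> on a function type is the product
  topology).\<close>

definition weak_operator_topology :: "('h::chilbert_space \<Rightarrow>\<^sub>L 'h) topology" where
  "weak_operator_topology =
     pullback_topology cblinops (\<lambda>T (x, y). cinner (blinfun_apply T x) y) euclidean"

definition von_neumann_algebra :: "('h::chilbert_space \<Rightarrow>\<^sub>L 'h) set \<Rightarrow> bool" where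
  "von_neumann_algebra M \<longleftrightarrow>
     M \<subseteq> cblinops \<and>
     id_blinfun \<in> M \<and>
     (\<forall>S\<in>M. \<forall>T\<in>M. S + T \<in> M) \<and>
     (\<forall>c. \<forall>T\<in>M. cscale_blinfun c T \<in> M) \<and>
     (\<forall>S\<in>M. \<forall>T\<in>M. S o\<^sub>L T \<in> M) \<and>
     (\<forall>T\<in>M. cadjoint T \<in> M) \<and>
     closedin weak_operator_topology M"

definition star_automorphism ::
    "('h::chilbert_space \<Rightarrow>\<^sub>L 'h) set \<Rightarrow> (('h \<Rightarrow>\<^sub>L 'h) \<Rightarrow> ('h \<Rightarrow>\<^sub>L 'h)) \<Rightarrow> bool" where
  "star_automorphism M \<phi> \<longleftrightarrow>
     bij_betw \<phi> M M \<and>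
     (\<forall>S\<in>M. \<forall>T\<in>M. \<phi> (S + T) = \<phi> S + \<phi> T) \<and>
     (\<forall>c. \<forall>T\<in>M. \<phi> (cscale_blinfun c T) = cscale_blinfun c (\<phi> T)) \<and>
     (\<forall>S\<in>M. \<forall>T\<in>M. \<phi> (S o\<^sub>L T) = \<phi> S o\<^sub>L \<phi> T) \<and>
     (\<forall>T\<in>M. \<phi> (cadjoint T) = cadjoint (\<phi> T))"


section \<open>Crossed products\<close>

text \<open>The discrete group \<open>G\<close> is the type \<open>'g\<close>.  Class \<^class>\<open>group_add\<close> does not assume
  commutativity; it only writes the group law additively: \<open>g + h\<close>, \<open>- g\<close> and \<open>0\<close> stand for
  \<open>gh\<close>, \<open>g\<close> inverse and the neutral element.\<close>

definition is_subgroup :: "'g::group_add set \<Rightarrow> bool" where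
  "is_subgroup H \<longleftrightarrow> 0 \<in> H \<and> (\<forall>g\<in>H. \<forall>h\<in>H. g + h \<in> H) \<and> (\<forall>g\<in>H. - g \<in> H)"

text \<open>The values of \<open>\<alpha> g\<close> outside \<open>M\<close> are irrelevant.\<close>

definition star_action ::
    "('h::chilbert_space \<Rightarrow>\<^sub>L 'h) set \<Rightarrow> ('g::group_add \<Rightarrow> ('h \<Rightarrow>\<^sub>L 'h) \<Rightarrow> ('h \<Rightarrow>\<^sub>L 'h)) \<Rightarrow> bool" where
  "star_action M \<alpha> \<longleftrightarrow>
     (\<forall>g. star_automorphism M (\<alpha> g)) \<and>
     (\<forall>a\<in>M. \<alpha> 0 a = a) \<and>
     (\<forall>g h. \<forall>a\<in>M. \<alpha> (g + h) a = \<alpha> g (\<alpha> h a))"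

text \<open>For \<open>a \<in> M\<close> and \<open>\<alpha>\<close> an action on the von Neumann algebra \<open>M\<close>, the operator
  \<open>crossed_pi \<alpha> a\<close> is well defined because *-automorphisms are contractive.\<close>

definition crossed_pi ::
    "('g::group_add \<Rightarrow> ('h::chilbert_space \<Rightarrow>\<^sub>L 'h) \<Rightarrow> ('h \<Rightarrow>\<^sub>L 'h)) \<Rightarrow> ('h \<Rightarrow>\<^sub>L 'h)
      \<Rightarrow> (('g, 'h) ell2 \<Rightarrow>\<^sub>L ('g, 'h) ell2)" where
  "crossed_pi \<alpha> a =
     Blinfun (\<lambda>\<xi>. Abs_ell2 (\<lambda>g. blinfun_apply (\<alpha> (- g) a) (ell2_apply \<xi> g)))"

definition crossed_lambda ::
    "'g::group_add \<Rightarrow> (('g, 'h::chilbert_space) ell2 \<Rightarrow>\<^sub>L ('g, 'h) ell2)" where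
  "crossed_lambda g = Blinfun (\<lambda>\<xi>. Abs_ell2 (\<lambda>h. ell2_apply \<xi> (- g + h)))"

text \<open>The von Neumann algebra generated by \<open>\<pi>(M)\<close> and \<open>\<lambda>(H)\<close>; the full crossed product is the
  case \<open>H = UNIV\<close>.  Since that is itself a von Neumann algebra containing the generators, the
  smallest von Neumann algebra in \<open>B(\<ell>\<^sup>2(G,\<H>))\<close> containing them agrees with the smallest one
  inside the full crossed product.\<close>

definition crossed_product ::
    "('h::chilbert_space \<Rightarrow>\<^sub>L 'h) set \<Rightarrow> ('g::group_add \<Rightarrow> ('h \<Rightarrow>\<^sub>L 'h) \<Rightarrow> ('h \<Rightarrow>\<^sub>L 'h))
      \<Rightarrow> 'g set \<Rightarrow> (('g, 'h) ell2 \<Rightarrow>\<^sub>L ('g, 'h) ell2) set" where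
  "crossed_product M \<alpha> H = von_neumann_algebra hull (crossed_pi \<alpha> ` M \<union> crossed_lambda ` H)"


section \<open>Distances between subspaces of a normed space\<close>

definition kadison_kastler_dist :: "'v::real_normed_vector set \<Rightarrow> 'v set \<Rightarrow> real" where
  "kadison_kastler_dist Y Z =
     max (SUP y\<in>Y \<inter> cball 0 1. infdist y (Z \<inter> cball 0 1))
         (SUP z\<in>Z \<inter> cball 0 1. infdist z (Y \<inter> cball 0 1))"

definition near_contained :: "real \<Rightarrow> 'v::real_normed_vector set \<Rightarrow> 'v set \<Rightarrow> bool" where
  "near_contained \<gamma> Y Z \<longleftrightarrow> (\<forall>y\<in>Y \<inter> cball 0 1. \<exists>z\<in>Z. norm (y - z) \<le> \<gamma>)"

definition christensen_dist :: "'v::real_normed_vector set \<Rightarrow> 'v set \<Rightarrow> real" where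
  "christensen_dist Y Z = Inf {\<gamma>. 0 < \<gamma> \<and> near_contained \<gamma> Y Z \<and> near_contained \<gamma> Z Y}"

end

theory Submission
  imports Defs
begin

text \<open>Both distances are at most \<open>1\<close> for any two subspaces, since \<open>0\<close> approximates every
  contraction within \<open>1\<close>.  For the lower bound let \<open>g\<close> lie in exactly one of the subgroups, say
  \<open>g \<in> H\<close> and \<open>g \<notin> K\<close>.  The generators \<open>\<pi>(a)\<close> are diagonal and the translations \<open>\<lambda>(k)\<close> with
  \<open>k \<in> K\<close> map \<open>K\<close> and its complement each onto itself, so all of \<open>M \<rtimes> K\<close> lies
  in the von Neumann algebra of operators that reduce \<open>\<ell>\<^sup>2(K)\<close> (\<open>crossed_product_block_diagonal\<close>).  The unitary \<open>\<lambda>(g)\<close> moves a unit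
  vector at the neutral element to the coordinate \<open>g\<close>, outside \<open>K\<close>, while an element of \<open>M \<rtimes> K\<close>
  gives it a component \<open>0\<close> there.  Hence \<open>\<lambda>(g) \<in> M \<rtimes> H\<close> has distance at least \<open>1\<close> from
  every element of \<open>M \<rtimes> K\<close> (\<open>norm_crossed_lambda_diff_ge_1\<close>).

  The analytic content is that \<open>\<pi>(a)\<close> is a bounded operator at all, which rests on automorphisms of
  a von Neumann algebra being contractive (\<open>star_automorphism_contractive\<close>).  This follows
  algebraically from the identity \<open>b\<^sup>* b + a\<^sup>* a = 1\<close>, which is solvable in the algebra whenever
  \<open>\<parallel>a\<parallel> < 1\<close> (\<open>vna_square_root_complement\<close>).  Adjoints exist by the Riesz representation theorem.\<close>

section \<open>Riesz representation and adjoints\<close>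

lemma bounded_bilinear_cinner: "bounded_bilinear (cinner :: 'h::chilbert_space \<Rightarrow> 'h \<Rightarrow> complex)"
proof
  fix a a' b b' :: 'h and r :: real
  show "cinner (a + a') b = cinner a b + cinner a' b"
    by (rule cinner_add_left)
  show "cinner a (b + b') = cinner a b + cinner a b'"
    by (rule cinner_add_right)
  show "cinner (r *\<^sub>R a) b = r *\<^sub>R cinner a b"
    by (simp add: scaleR_scaleC cinner_scaleC_left scaleR_conv_of_real)
  show "cinner a (r *\<^sub>R b) = r *\<^sub>R cinner a b"
    by (simp add: scaleR_scaleC cinner_scaleC_right scaleR_conv_of_real)
  show "\<exists>K. \<forall>a b :: 'h. norm (cinner a b) \<le> norm a * norm b * K"
    by (rule exI[of _ 1]) (simp add: norm_cinner_le)
qed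

interpretation cinner: bounded_bilinear "cinner :: 'h::chilbert_space \<Rightarrow> 'h \<Rightarrow> complex"
  by (rule bounded_bilinear_cinner)

declare cinner.continuous_on [continuous_intros]

lemma cinner_eqI:
  fixes x y :: "'h::chilbert_space"
  assumes "\<And>z. cinner z x = cinner z y"
  shows "x = y"
proof -
  have "cinner (x - y) (x - y) = 0"
    using assms by (simp add: cinner.diff_right)
  then show ?thesis
    by (simp add: cinner_self)
qed

lemma norm_add_sq:
  fixes x y :: "'h::chilbert_space"
  shows "(norm (x + y))\<^sup>2 = (norm x)\<^sup>2 + (norm y)\<^sup>2 + 2 * Re (cinner x y)"
proof -
  have "complex_of_real ((norm (x + y))\<^sup>2)
      = complex_of_real ((norm x)\<^sup>2) + complex_of_real ((norm y)\<^sup>2) + (cinner x y + cnj (cinner x y))"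
    unfolding cinner_self[symmetric] using cinner_commute[of y x]
    by (simp add: cinner_add_left cinner_add_right)
  also have "\<dots> = complex_of_real ((norm x)\<^sup>2 + (norm y)\<^sup>2 + 2 * Re (cinner x y))"
    by (simp add: complex_eq_iff)
  finally show ?thesis
    using of_real_eq_iff by blast
qed

lemma norm_diff_sq:
  fixes x y :: "'h::chilbert_space"
  shows "(norm (x - y))\<^sup>2 = (norm x)\<^sup>2 + (norm y)\<^sup>2 - 2 * Re (cinner x y)"
  using norm_add_sq[of x "- y"] by (simp add: cinner.minus_right)

text \<open>The first-order condition at a minimum of a quadratic polynomial in \<open>t\<close>.\<close>

lemma linear_coefficient_zero:
  fixes a b :: real
  assumes "0 \<le> a" and nonneg: "\<And>t. 0 \<le> t\<^sup>2 * a + 2 * t * b"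
  shows "b = 0"
proof -
  define c where "c = b / (a + 1)"
  have b: "b = c * (a + 1)"
    using \<open>0 \<le> a\<close> by (simp add: c_def)
  have "c\<^sup>2 * (a + 2) \<le> 0"
    using nonneg[of "- c"] by (simp add: b power2_eq_square algebra_simps)
  then show ?thesis
    using \<open>0 \<le> a\<close> by (simp add: b mult_le_0_iff)
qed

text \<open>The representing vector minimises the function \<open>Q x = \<parallel>x\<parallel>\<^sup>2 - 2 Re (f x)\<close>: by the
  parallelogram law every minimising sequence is Cauchy, and the first variation of \<open>Q\<close> at the minimum vanishes.\<close>

lemma riesz_representation:
  fixes f :: "'h::chilbert_space \<Rightarrow> complex"
  assumes add: "\<And>x y. f (x + y) = f x + f y" and scale: "\<And>c x. f (c *\<^sub>C x) = c * f x"
    and bound: "\<And>x. cmod (f x) \<le> B * norm x"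
  shows "\<exists>z. \<forall>x. f x = cinner x z"
proof -
  have scaleR: "f (r *\<^sub>R x) = r *\<^sub>R f x" for r x
    by (simp add: scaleR_scaleC scale scaleR_conv_of_real)
  interpret f: bounded_linear f
    by (rule bounded_linear_intro[of _ B]) (auto simp: add scaleR bound mult.commute)
  define Q where "Q x = (norm x)\<^sup>2 - 2 * Re (f x)" for x
  define m where "m = Inf (range Q)"
  have "- B\<^sup>2 \<le> Q x" for x
  proof -
    have "0 \<le> (norm x - B)\<^sup>2"
      by simp
    moreover have "Re (f x) \<le> B * norm x"
      using complex_Re_le_cmod[of "f x"] bound[of x] by linarith
    ultimately show ?thesis
      by (simp add: Q_def power2_diff mult.commute)
  qed
  then have "bdd_below (range Q)"
    by (rule bdd_belowI2)
  then have m_le: "m \<le> Q x" for x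
    unfolding m_def by (simp add: cInf_lower)
  have parallelogram: "(norm (x - y))\<^sup>2 = 2 * Q x + 2 * Q y - 4 * Q ((1/2) *\<^sub>R (x + y))" for x y
    unfolding Q_def scaleR add norm_scaleR power_mult_distrib
    by (simp add: norm_add_sq norm_diff_sq power_divide algebra_simps)
  have "\<exists>x. Q x < m + inverse (real (Suc n))" for n
    using cInf_lessD[of "range Q" "m + inverse (real (Suc n))"] unfolding m_def
    by (auto simp del: of_nat_Suc)
  then obtain X where X: "\<And>n. Q (X n) < m + inverse (real (Suc n))"
    by metis
  have "Cauchy X"
  proof (rule CauchyI)
    fix e :: real assume "0 < e"
    then obtain N where N: "inverse (real (Suc N)) < e\<^sup>2 / 4"
      using reals_Archimedean[of "e\<^sup>2 / 4"] by auto
    have small: "Q (X n) < m + e\<^sup>2 / 4" if "N \<le> n" for n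
    proof -
      have "inverse (real (Suc n)) \<le> inverse (real (Suc N))"
        using that by (simp add: le_imp_inverse_le)
      then show ?thesis
        using X[of n] N by linarith
    qed
    have "norm (X k - X n) < e" if "N \<le> k" "N \<le> n" for k n
    proof -
      have "(norm (X k - X n))\<^sup>2 < e\<^sup>2"
        using parallelogram[of "X k" "X n"] small[OF that(1)] small[OF that(2)]
          m_le[of "(1/2) *\<^sub>R (X k + X n)"] by linarith
      then show ?thesis
        using \<open>0 < e\<close> by (simp add: power2_less_imp_less)
    qed
    then show "\<exists>M. \<forall>k\<ge>M. \<forall>n\<ge>M. norm (X k - X n) < e"
      by blast
  qed
  then obtain z where z: "X \<longlonglongrightarrow> z"
    using Cauchy_convergent convergent_def by blast
  have "Q z \<le> m"
  proof (rule LIMSEQ_le)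
    show "(\<lambda>n. Q (X n)) \<longlonglongrightarrow> Q z"
      unfolding Q_def by (intro tendsto_intros f.tendsto z)
    show "(\<lambda>n. m + inverse (real (Suc n))) \<longlonglongrightarrow> m"
      using tendsto_add[OF tendsto_const LIMSEQ_inverse_real_of_nat, of m] by simp
    show "\<exists>N. \<forall>n\<ge>N. Q (X n) \<le> m + inverse (real (Suc n))"
      using X by (auto intro: less_imp_le)
  qed
  then have min: "Q z \<le> Q x" for x
    using m_le[of x] by linarith
  have Re: "Re (f x) = Re (cinner x z)" for x
  proof -
    have "Re (cinner z x) - Re (f x) = 0"
    proof (rule linear_coefficient_zero[where a = "(norm x)\<^sup>2"])
      show "0 \<le> t\<^sup>2 * (norm x)\<^sup>2 + 2 * t * (Re (cinner z x) - Re (f x))" for t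
        using min[of "z + t *\<^sub>R x"] unfolding Q_def norm_add_sq
        by (simp add: add scaleR cinner.scaleR_right power_mult_distrib algebra_simps)
    qed simp
    then show ?thesis
      using cinner_commute[of z x] by simp
  qed
  \<comment> \<open>The imaginary parts are the real parts at \<open>\<i> x\<close>.\<close>
  have "f x = cinner x z" for x
    using Re[of x] Re[of "\<i> *\<^sub>C x"] by (simp add: scale cinner_scaleC_left complex_eq_iff)
  then show ?thesis
    by blast
qed

lemma cblinops_scaleC: "T \<in> cblinops \<Longrightarrow> blinfun_apply T (c *\<^sub>C x) = c *\<^sub>C blinfun_apply T x"
  by (simp add: cblinops_def)

lemma cblinopsI:
  "(\<And>c x. blinfun_apply T (c *\<^sub>C x) = c *\<^sub>C blinfun_apply T x) \<Longrightarrow> T \<in> cblinops"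
  by (simp add: cblinops_def)

lemma adjoint_exists:
  fixes T :: "'h::chilbert_space \<Rightarrow>\<^sub>L 'h"
  assumes T: "T \<in> cblinops"
  shows "\<exists>S. \<forall>x y. cinner (blinfun_apply T x) y = cinner x (blinfun_apply S y)"
proof -
  have "\<exists>z. \<forall>x. cinner (blinfun_apply T x) y = cinner x z" for y
  proof (rule riesz_representation)
    fix x
    have "cmod (cinner (blinfun_apply T x) y) \<le> norm (blinfun_apply T x) * norm y"
      by (rule norm_cinner_le)
    also have "\<dots> \<le> norm T * norm x * norm y"
      by (intro mult_right_mono norm_blinfun) auto
    finally show "cmod (cinner (blinfun_apply T x) y) \<le> norm T * norm y * norm x"
      by (simp add: mult_ac)
  qed (auto simp: blinfun.add_right cinner_add_left cblinops_scaleC[OF T] cinner_scaleC_left)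
  then obtain S where S: "\<And>x y. cinner (blinfun_apply T x) y = cinner x (S y)"
    by metis
  have "bounded_linear S"
  proof (rule bounded_linear_intro[of _ "norm T"])
    show "S (x + y) = S x + S y" for x y
      by (rule cinner_eqI) (simp add: S[symmetric] cinner_add_right)
    show "S (r *\<^sub>R x) = r *\<^sub>R S x" for r x
      by (rule cinner_eqI) (simp add: S[symmetric] cinner.scaleR_right)
    show "norm (S y) \<le> norm y * norm T" for y
    proof (cases "S y = 0")
      case False
      have "(norm (S y))\<^sup>2 = Re (cinner (blinfun_apply T (S y)) y)"
        by (simp add: S cinner_self flip: of_real_power)
      also have "\<dots> \<le> norm (blinfun_apply T (S y)) * norm y"
        by (rule Re_cinner_le)
      also have "\<dots> \<le> norm T * norm (S y) * norm y"
        by (intro mult_right_mono norm_blinfun) auto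
      finally show ?thesis
        using False by (simp add: power2_eq_square mult_ac)
    qed simp
  qed
  then show ?thesis
    by (intro exI[of _ "Blinfun S"]) (simp add: bounded_linear_Blinfun_apply S)
qed

lemma cinner_adjoint:
  fixes T :: "'h::chilbert_space \<Rightarrow>\<^sub>L 'h"
  assumes "T \<in> cblinops"
  shows "cinner (blinfun_apply T x) y = cinner x (blinfun_apply (cadjoint T) y)"
proof -
  obtain S where S: "\<forall>x y. cinner (blinfun_apply T x) y = cinner x (blinfun_apply S y)"
    using adjoint_exists[OF assms] by blast
  have "\<forall>x y. cinner (blinfun_apply T x) y = cinner x (blinfun_apply (cadjoint T) y)"
    unfolding cadjoint_def
  proof (rule theI[where a = S])
    fix R assume "\<forall>x y. cinner (blinfun_apply T x) y = cinner x (blinfun_apply R y)"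
    then show "R = S"
      using S by (intro blinfun_eqI cinner_eqI) metis
  qed (rule S)
  then show ?thesis
    by blast
qed

lemma cinner_adjoint_left:
  fixes T :: "'h::chilbert_space \<Rightarrow>\<^sub>L 'h"
  assumes "T \<in> cblinops"
  shows "cinner (blinfun_apply (cadjoint T) x) y = cinner x (blinfun_apply T y)"
  by (metis assms cinner_adjoint cinner_commute)

lemma cadjoint_unique:
  fixes T :: "'h::chilbert_space \<Rightarrow>\<^sub>L 'h"
  assumes "T \<in> cblinops"
    and "\<And>x y. cinner (blinfun_apply T x) y = cinner x (blinfun_apply S y)"
  shows "cadjoint T = S"
  using assms cinner_adjoint[OF assms(1)] by (intro blinfun_eqI cinner_eqI) metis

lemma cadjoint_cblinops:
  fixes T :: "'h::chilbert_space \<Rightarrow>\<^sub>L 'h"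
  assumes "T \<in> cblinops"
  shows "cadjoint T \<in> cblinops"
  by (intro cblinopsI cinner_eqI)
    (simp add: cinner_adjoint[OF assms, symmetric] cinner_scaleC_right)

lemma cscale_blinfun_apply [simp]:
  "blinfun_apply (cscale_blinfun c T) x = c *\<^sub>C blinfun_apply T x"
proof -
  have "bounded_linear (\<lambda>x. c *\<^sub>C blinfun_apply T x)"
  proof (rule bounded_linear_intro[of _ "cmod c * norm T"])
    show "c *\<^sub>C blinfun_apply T (r *\<^sub>R x) = r *\<^sub>R c *\<^sub>C blinfun_apply T x" for r x
      unfolding blinfun.scaleR_right by (simp add: scaleR_scaleC scaleC_scaleC mult.commute)
    show "norm (c *\<^sub>C blinfun_apply T x) \<le> norm x * (cmod c * norm T)" for x
      using mult_left_mono[OF norm_blinfun[of T x], of "cmod c"] by (simp add: norm_scaleC mult_ac)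
  qed (simp add: blinfun.add_right scaleC_add_right)
  then show ?thesis
    by (simp add: cscale_blinfun_def bounded_linear_Blinfun_apply)
qed

lemma cscale_blinfun_of_real: "cscale_blinfun (complex_of_real r) T = r *\<^sub>R T"
  by (rule blinfun_eqI) (simp add: blinfun.scaleR_left scaleR_scaleC)

section \<open>Von Neumann algebras are norm closed\<close>

lemma closed_cblinops: "closed (cblinops :: ('h::chilbert_space \<Rightarrow>\<^sub>L 'h) set)"
proof -
  have eq: "cblinops = (\<Inter>c. \<Inter>x. \<Inter>y. {T :: 'h \<Rightarrow>\<^sub>L 'h.
      cinner (blinfun_apply T (c *\<^sub>C x)) y = c * cinner (blinfun_apply T x) y})"
    by (auto simp: cblinops_def cinner_scaleC_left[symmetric])
      (metis cinner_commute cinner_eqI)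
  show ?thesis
    unfolding eq by (intro closed_INT ballI closed_Collect_eq continuous_intros)
qed

lemma continuous_map_wot:
  "continuous_map weak_operator_topology euclidean (\<lambda>T. cinner (blinfun_apply T x) y)"
proof -
  have "continuous_map weak_operator_topology euclidean
      ((\<lambda>f. f (x, y)) \<circ> (\<lambda>T (x, y). cinner (blinfun_apply T x) y))"
    unfolding weak_operator_topology_def
    by (intro continuous_map_pullback) (simp add: continuous_map_iff_continuous2)
  then show ?thesis
    by (simp add: o_def)
qed

lemma topspace_wot: "topspace weak_operator_topology = cblinops"
  by (simp add: weak_operator_topology_def topspace_pullback_topology)

text \<open>On \<open>B(\<H>)\<close> the norm topology refines the weak operator topology, and \<open>B(\<H>)\<close> is itself norm
  closed among the real-linear bounded operators.  Completeness in norm then makes fixed-point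
  arguments available inside a von Neumann algebra.\<close>

lemma closedin_wot_imp_closed:
  fixes M :: "('h::chilbert_space \<Rightarrow>\<^sub>L 'h) set"
  assumes "closedin weak_operator_topology M"
  shows "closed M"
proof -
  define F where "F = (\<lambda>(T :: 'h \<Rightarrow>\<^sub>L 'h) (x, y). cinner (blinfun_apply T x) y)"
  have "openin weak_operator_topology (cblinops - M)" and M: "M \<subseteq> cblinops"
    using assms by (auto simp: closedin_def topspace_wot)
  then obtain U where "open U" and U: "cblinops - M = F -` U \<inter> cblinops"
    by (auto simp: weak_operator_topology_def openin_pullback_topology F_def)
  have "continuous_on UNIV F"
    unfolding F_def
    by (intro continuous_on_coordinatewise_then_product) (auto split: prod.split intro!: continuous_intros)
  then have "open (F -` U)"
    using \<open>open U\<close> open_vimage by blast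
  moreover have "M = cblinops - F -` U"
    using U M by blast
  ultimately show ?thesis
    by (simp add: closed_Diff closed_cblinops)
qed

context
  fixes M :: "('h::chilbert_space \<Rightarrow>\<^sub>L 'h) set"
  assumes vna: "von_neumann_algebra M"
begin

lemma vna_cblinops: "T \<in> M \<Longrightarrow> T \<in> cblinops"
  and vna_id: "id_blinfun \<in> M"
  and vna_add: "S \<in> M \<Longrightarrow> T \<in> M \<Longrightarrow> S + T \<in> M"
  and vna_compose: "S \<in> M \<Longrightarrow> T \<in> M \<Longrightarrow> S o\<^sub>L T \<in> M"
  and vna_adjoint: "T \<in> M \<Longrightarrow> cadjoint T \<in> M"
  and vna_closed: "closed M"
  using vna by (auto simp: von_neumann_algebra_def intro: closedin_wot_imp_closed)

lemma vna_scaleR: "T \<in> M \<Longrightarrow> r *\<^sub>R T \<in> M"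
  using vna unfolding von_neumann_algebra_def by (metis cscale_blinfun_of_real)

lemma vna_zero: "0 \<in> M"
  using vna_scaleR[OF vna_id, of 0] by simp

lemma vna_diff: "S \<in> M \<Longrightarrow> T \<in> M \<Longrightarrow> S - T \<in> M"
  using vna_add[of S "(-1) *\<^sub>R T"] vna_scaleR[of T "-1"] by simp

end


section \<open>Star-automorphisms are contractive\<close>

lemma norm_cadjoint_compose_le:
  fixes a :: "'h::chilbert_space \<Rightarrow>\<^sub>L 'h"
  assumes a: "a \<in> cblinops"
  shows "norm (cadjoint a o\<^sub>L a) \<le> (norm a)\<^sup>2"
proof (rule norm_blinfun_bound)
  fix x
  let ?y = "blinfun_apply (cadjoint a o\<^sub>L a) x"
  show "norm ?y \<le> (norm a)\<^sup>2 * norm x"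
  proof (cases "?y = 0")
    case False
    have "(norm ?y)\<^sup>2 = Re (cinner (blinfun_apply a x) (blinfun_apply a ?y))"
      by (metis Re_complex_of_real blinfun_apply_blinfun_compose cinner_adjoint_left[OF a] cinner_self)
    also have "\<dots> \<le> norm (blinfun_apply a x) * norm (blinfun_apply a ?y)"
      by (rule Re_cinner_le)
    also have "\<dots> \<le> (norm a * norm x) * (norm a * norm ?y)"
      by (intro mult_mono norm_blinfun) auto
    finally show ?thesis
      using False by (simp add: power2_eq_square mult_ac)
  qed simp
qed simp

text \<open>The operator \<open>b\<close> is the square root of \<open>1 - a\<^sup>* a\<close>.  Writing \<open>T = a\<^sup>* a\<close> and \<open>b = 1 - Y\<close>,
  the equation \<open>b\<^sup>2 = 1 - T\<close> reads \<open>Y = (T + Y\<^sup>2) / 2\<close>, whose right-hand side is a contraction on the self-adjoint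
  elements of \<open>M\<close> of norm at most \<open>\<parallel>T\<parallel> < 1\<close>.\<close>

lemma vna_square_root_complement:
  fixes M :: "('h::chilbert_space \<Rightarrow>\<^sub>L 'h) set"
  assumes M: "von_neumann_algebra M" and a: "a \<in> M" and "norm a < 1"
  shows "\<exists>b\<in>M. (cadjoint b o\<^sub>L b) + (cadjoint a o\<^sub>L a) = id_blinfun"
proof -
  define T where "T = cadjoint a o\<^sub>L a"
  define r where "r = norm T"
  define f where "f Y = (1/2) *\<^sub>R (T + (Y o\<^sub>L Y))" for Y :: "'h \<Rightarrow>\<^sub>L 'h"
  define symm where "symm Y \<longleftrightarrow> (\<forall>x y. cinner (blinfun_apply Y x) y = cinner x (blinfun_apply Y y))"
    for Y :: "'h \<Rightarrow>\<^sub>L 'h"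
  define S where "S = M \<inter> {Y. symm Y} \<inter> cball 0 r"
  have a_op: "a \<in> cblinops"
    using vna_cblinops[OF M a] .
  have T: "T \<in> M" "symm T"
    using a by (auto simp: T_def symm_def vna_compose[OF M] vna_adjoint[OF M]
        cinner_adjoint[OF a_op] cinner_adjoint_left[OF a_op])
  have "r \<le> (norm a)\<^sup>2"
    unfolding r_def T_def by (rule norm_cadjoint_compose_le[OF a_op])
  also have "\<dots> < 1"
    using \<open>norm a < 1\<close> by (simp add: power_less_one_iff abs_square_less_1)
  finally have r: "0 \<le> r" "r < 1"
    by (auto simp: r_def)
  have "closed {Y. symm Y}"
    unfolding symm_def by (intro closed_Collect_all closed_Collect_eq continuous_intros)
  then have "complete S"
    unfolding S_def by (intro closed_Int vna_closed[OF M] closed_cball complete_eq_closed[THEN iffD2])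
  moreover have "0 \<in> S"
    using vna_zero[OF M] r by (simp add: S_def symm_def cinner.zero_left cinner.zero_right)
  then have "S \<noteq> {}"
    by blast
  moreover have "f ` S \<subseteq> S"
  proof safe
    fix Y assume "Y \<in> S"
    then have Y: "Y \<in> M" "symm Y" "norm Y \<le> r"
      by (auto simp: S_def)
    have "norm (f Y) \<le> (1/2) * (norm T + norm Y * norm Y)"
      unfolding f_def using norm_triangle_ineq[of T "Y o\<^sub>L Y"] norm_blinfun_compose[of Y Y] by simp
    also have "\<dots> \<le> (1/2) * (r + r * 1)"
      using Y(3) r by (intro mult_left_mono add_mono mult_mono) (auto simp: r_def)
    finally have "norm (f Y) \<le> r"
      by simp
    moreover have "symm (f Y)"
      using Y(2) T(2) by (simp add: f_def symm_def blinfun.add_left blinfun.scaleR_left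
          cinner.scaleR_left cinner.scaleR_right cinner.add_left cinner.add_right)
    ultimately show "f Y \<in> S"
      using Y(1) T(1) by (auto simp: S_def f_def intro!: vna_scaleR[OF M] vna_add[OF M] vna_compose[OF M])
  qed
  moreover have "dist (f Y) (f Z) \<le> r * dist Y Z" if "Y \<in> S" "Z \<in> S" for Y Z
  proof -
    have "f Y - f Z = (1/2) *\<^sub>R ((Y o\<^sub>L (Y - Z)) + ((Y - Z) o\<^sub>L Z))"
      by (rule blinfun_eqI) (simp add: f_def blinfun.bilinear_simps algebra_simps)
    then have "norm (f Y - f Z) \<le> (1/2) * (norm Y * norm (Y - Z) + norm (Y - Z) * norm Z)"
      using norm_triangle_ineq[of "Y o\<^sub>L (Y - Z)" "(Y - Z) o\<^sub>L Z"]
        norm_blinfun_compose[of Y "Y - Z"] norm_blinfun_compose[of "Y - Z" Z] by simp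
    also have "\<dots> \<le> (1/2) * (r * norm (Y - Z) + norm (Y - Z) * r)"
      using that r by (intro mult_left_mono add_mono mult_mono) (auto simp: S_def)
    finally show ?thesis
      by (simp add: dist_norm)
  qed
  ultimately obtain Y where "Y \<in> S" "f Y = Y"
    using Banach_fix[of S r f] r by blast
  then have Y: "Y \<in> M" "symm Y"
    by (auto simp: S_def)
  let ?b = "id_blinfun - Y"
  have b: "?b \<in> M"
    by (intro vna_diff[OF M] vna_id[OF M] Y)
  have "cadjoint ?b = ?b"
    using Y(2) by (intro cadjoint_unique vna_cblinops[OF M b])
      (simp add: symm_def blinfun.diff_left cinner.diff_left cinner.diff_right)
  moreover have "(?b o\<^sub>L ?b) + T = id_blinfun"
  proof (rule blinfun_eqI)
    fix x
    have "2 *\<^sub>R blinfun_apply Y x = 2 *\<^sub>R blinfun_apply (f Y) x"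
      using \<open>f Y = Y\<close> by simp
    then have "2 *\<^sub>R blinfun_apply Y x = blinfun_apply T x + blinfun_apply Y (blinfun_apply Y x)"
      by (simp add: f_def blinfun.bilinear_simps)
    then show "blinfun_apply ((?b o\<^sub>L ?b) + T) x = blinfun_apply id_blinfun x"
      by (simp add: blinfun.bilinear_simps scaleR_2 algebra_simps)
  qed
  ultimately show ?thesis
    using b by (intro bexI[of _ ?b]) (simp_all add: T_def)
qed

text \<open>An automorphism carries the identity \<open>b\<^sup>* b + a\<^sup>* a = 1\<close> to \<open>\<phi>(b)\<^sup>* \<phi>(b) + \<phi>(a)\<^sup>* \<phi>(a) = 1\<close>, so
  \<open>\<parallel>\<phi>(a) x\<parallel>\<^sup>2 \<le> \<parallel>x\<parallel>\<^sup>2\<close> for every \<open>x\<close>.\<close>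

lemma star_automorphism_contractive:
  fixes M :: "('h::chilbert_space \<Rightarrow>\<^sub>L 'h) set"
  assumes M: "von_neumann_algebra M" and \<phi>: "star_automorphism M \<phi>" and a: "a \<in> M"
  shows "norm (\<phi> a) \<le> norm a"
proof -
  have bij: "bij_betw \<phi> M M"
    and add: "\<And>S T. S \<in> M \<Longrightarrow> T \<in> M \<Longrightarrow> \<phi> (S + T) = \<phi> S + \<phi> T"
    and scale: "\<And>c T. T \<in> M \<Longrightarrow> \<phi> (cscale_blinfun c T) = cscale_blinfun c (\<phi> T)"
    and compose: "\<And>S T. S \<in> M \<Longrightarrow> T \<in> M \<Longrightarrow> \<phi> (S o\<^sub>L T) = \<phi> S o\<^sub>L \<phi> T"
    and adjoint: "\<And>T. T \<in> M \<Longrightarrow> \<phi> (cadjoint T) = cadjoint (\<phi> T)"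
    using \<phi> by (auto simp: star_automorphism_def)
  have closed: "\<phi> T \<in> M" if "T \<in> M" for T
    using bij that by (auto simp: bij_betw_def)
  have "id_blinfun \<in> \<phi> ` M"
    using bij vna_id[OF M] by (simp add: bij_betw_def)
  then obtain e where e: "e \<in> M" "\<phi> e = id_blinfun"
    by force
  have "id_blinfun o\<^sub>L e = e" "\<phi> id_blinfun o\<^sub>L id_blinfun = \<phi> id_blinfun"
    by (auto intro: blinfun_eqI)
  then have id: "\<phi> id_blinfun = id_blinfun"
    using compose[OF vna_id[OF M] e(1)] e(2) by simp
  have contractive: "norm (\<phi> c) \<le> 1" if c: "c \<in> M" and "norm c < 1" for c
  proof -
    obtain b where b: "b \<in> M" "(cadjoint b o\<^sub>L b) + (cadjoint c o\<^sub>L c) = id_blinfun"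
      using vna_square_root_complement[OF M c \<open>norm c < 1\<close>] by blast
    have "id_blinfun = \<phi> ((cadjoint b o\<^sub>L b) + (cadjoint c o\<^sub>L c))"
      by (simp add: b id)
    also have "\<dots> = (cadjoint (\<phi> b) o\<^sub>L \<phi> b) + (cadjoint (\<phi> c) o\<^sub>L \<phi> c)"
      using b(1) c by (simp add: add compose adjoint vna_compose[OF M] vna_adjoint[OF M])
    finally have one: "blinfun_apply ((cadjoint (\<phi> b) o\<^sub>L \<phi> b) + (cadjoint (\<phi> c) o\<^sub>L \<phi> c)) x = x" for x
      by (metis blinfun_apply_id_blinfun id_apply)
    have "norm (blinfun_apply (\<phi> c) x) \<le> 1 * norm x" for x
    proof -
      have "cinner x x = cinner (blinfun_apply (\<phi> b) x) (blinfun_apply (\<phi> b) x)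
          + cinner (blinfun_apply (\<phi> c) x) (blinfun_apply (\<phi> c) x)"
        by (subst (2) one[of x, symmetric])
          (simp add: blinfun.add_left cinner_add_right cinner_adjoint[symmetric]
            vna_cblinops[OF M closed] b(1) c)
      then have "(norm x)\<^sup>2 = (norm (blinfun_apply (\<phi> b) x))\<^sup>2 + (norm (blinfun_apply (\<phi> c) x))\<^sup>2"
        unfolding cinner_self of_real_add[symmetric] of_real_eq_iff .
      then have "(norm (blinfun_apply (\<phi> c) x))\<^sup>2 \<le> (norm x)\<^sup>2"
        by simp
      then show ?thesis
        by (simp add: power2_le_iff_abs_le)
    qed
    then show ?thesis
      by (intro norm_blinfun_bound) auto
  qed
  show ?thesis
  proof (rule field_le_epsilon)
    fix d :: real assume "0 < d"
    \<comment> \<open>Rescale \<open>a\<close> into the open unit ball.\<close>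
    define s where "s = norm a + d"
    have s: "0 < s" "norm a < s"
      using \<open>0 < d\<close> norm_ge_zero[of a] unfolding s_def by linarith+
    have "norm (inverse s *\<^sub>R a) < 1"
      using s by (simp add: field_simps)
    then have "norm (\<phi> (inverse s *\<^sub>R a)) \<le> 1"
      by (intro contractive vna_scaleR[OF M] a)
    moreover have "\<phi> (inverse s *\<^sub>R a) = inverse s *\<^sub>R \<phi> a"
      using scale[OF a, of "complex_of_real (inverse s)"] by (simp only: cscale_blinfun_of_real)
    ultimately show "norm (\<phi> a) \<le> norm a + d"
      using s by (simp add: field_simps s_def)
  qed
qed


section \<open>The generators of the crossed product\<close>

lemma ell2_eqI: "(\<And>g. ell2_apply \<xi> g = ell2_apply \<eta> g) \<Longrightarrow> \<xi> = \<eta>"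
  by (simp add: ell2_apply_inject[symmetric] fun_eq_iff)

lemma ell2_dominated:
  assumes "0 \<le> c" and le: "\<And>g. norm (f g) \<le> c * norm (ell2_apply \<xi> g)"
  shows "(\<lambda>g. (norm (f g))\<^sup>2) summable_on UNIV"
    and "norm (Abs_ell2 f) \<le> c * norm \<xi>"
proof -
  have "L2_set (\<lambda>g. norm (f g)) F \<le> c * norm \<xi>" if "finite F" for F
  proof -
    have "L2_set (\<lambda>g. norm (f g)) F \<le> L2_set (\<lambda>g. c * norm (ell2_apply \<xi> g)) F"
      by (intro L2_set_mono le) auto
    also have "\<dots> = c * L2_set (\<lambda>g. norm (ell2_apply \<xi> g)) F"
      using \<open>0 \<le> c\<close> by (simp add: L2_set_right_distrib)
    also have "\<dots> \<le> c * norm \<xi>"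
      using L2_set_le_ell2[OF ell2_apply[of \<xi>, simplified] that] \<open>0 \<le> c\<close>
      by (intro mult_left_mono) (auto simp: norm_ell2.rep_eq)
    finally show ?thesis .
  qed
  then show s: "(\<lambda>g. (norm (f g))\<^sup>2) summable_on UNIV" and "norm (Abs_ell2 f) \<le> c * norm \<xi>"
    using ell2I[of f "c * norm \<xi>"] by (auto simp: norm_ell2.rep_eq Abs_ell2_inverse)
qed

text \<open>The defining formula of \<open>\<pi>(a)\<close> is meaningful only if it gives square-summable functions and a
  bounded operator; both follow from the bound \<open>\<parallel>\<alpha> (- g) a\<parallel> \<le> \<parallel>a\<parallel>\<close>, which is uniform in \<open>g\<close>.\<close>

lemma crossed_pi_apply:
  fixes M :: "('h::chilbert_space \<Rightarrow>\<^sub>L 'h) set"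
    and \<alpha> :: "'g::group_add \<Rightarrow> ('h \<Rightarrow>\<^sub>L 'h) \<Rightarrow> ('h \<Rightarrow>\<^sub>L 'h)"
  assumes M: "von_neumann_algebra M" and \<alpha>: "star_action M \<alpha>" and a: "a \<in> M"
  shows "ell2_apply (blinfun_apply (crossed_pi \<alpha> a) \<xi>) g = blinfun_apply (\<alpha> (- g) a) (ell2_apply \<xi> g)"
proof -
  define P where "P \<xi> = Abs_ell2 (\<lambda>g. blinfun_apply (\<alpha> (- g) a) (ell2_apply \<xi> g))" for \<xi>
  have bound: "norm (blinfun_apply (\<alpha> (- g) a) x) \<le> norm a * norm x" for g x
  proof -
    have "norm (blinfun_apply (\<alpha> (- g) a) x) \<le> norm (\<alpha> (- g) a) * norm x"
      by (rule norm_blinfun)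
    also have "\<dots> \<le> norm a * norm x"
      using star_automorphism_contractive[OF M _ a, of "\<alpha> (- g)"] \<alpha>
      by (intro mult_right_mono) (auto simp: star_action_def)
    finally show ?thesis .
  qed
  have P: "ell2_apply (P \<xi>) g = blinfun_apply (\<alpha> (- g) a) (ell2_apply \<xi> g)" for \<xi> g
    unfolding P_def
    using ell2_dominated(1)[of "norm a" "\<lambda>g. blinfun_apply (\<alpha> (- g) a) (ell2_apply \<xi> g)" \<xi>] bound
    by (simp add: Abs_ell2_inverse)
  have "bounded_linear P"
  proof (rule bounded_linear_intro[of _ "norm a"])
    show "norm (P \<xi>) \<le> norm \<xi> * norm a" for \<xi>
      using ell2_dominated(2)[OF norm_ge_zero bound] by (simp add: P_def mult.commute)
  qed (auto intro!: ell2_eqI simp: P plus_ell2.rep_eq scaleR_ell2.rep_eq blinfun.bilinear_simps)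
  then have "blinfun_apply (crossed_pi \<alpha> a) = P"
    unfolding crossed_pi_def P_def[abs_def] by (rule bounded_linear_Blinfun_apply)
  then show ?thesis
    by (simp add: P)
qed

lemma bij_translate: "bij (\<lambda>h. - g + h :: 'g::group_add)"
  by (rule bij_betw_byWitness[where f' = "\<lambda>h. g + h"]) (auto simp: add.assoc[symmetric])

lemma
  fixes g :: "'g::group_add" and \<xi> :: "('g, 'h::chilbert_space) ell2"
  shows crossed_lambda_apply:
      "ell2_apply (blinfun_apply (crossed_lambda g) \<xi>) h = ell2_apply \<xi> (- g + h)"
    and norm_crossed_lambda_le: "norm (crossed_lambda g :: ('g, 'h) ell2 \<Rightarrow>\<^sub>L ('g, 'h) ell2) \<le> 1"
proof -
  define L where "L \<xi> = Abs_ell2 (\<lambda>h. ell2_apply \<xi> (- g + h))" for \<xi> :: "('g, 'h) ell2"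
  have L: "ell2_apply (L \<xi>) h = ell2_apply \<xi> (- g + h)" for \<xi> h
    unfolding L_def
    using summable_on_reindex_bij_betw[OF bij_translate, of "\<lambda>h. (norm (ell2_apply \<xi> h))\<^sup>2"]
      ell2_apply[of \<xi>] by (simp add: Abs_ell2_inverse)
  have norm_L: "norm (L \<xi>) = norm \<xi>" for \<xi>
    using infsum_reindex_bij_betw[OF bij_translate, of "\<lambda>h. (norm (ell2_apply \<xi> h))\<^sup>2"]
    by (simp add: norm_ell2.rep_eq L)
  have "bounded_linear L"
    by (rule bounded_linear_intro[of _ 1])
      (auto intro!: ell2_eqI simp: L norm_L plus_ell2.rep_eq scaleR_ell2.rep_eq)
  then have L_apply: "blinfun_apply (crossed_lambda g) = L"
    unfolding crossed_lambda_def L_def[abs_def] by (rule bounded_linear_Blinfun_apply)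
  show "ell2_apply (blinfun_apply (crossed_lambda g) \<xi>) h = ell2_apply \<xi> (- g + h)"
    by (simp add: L_apply L)
  show "norm (crossed_lambda g :: ('g, 'h) ell2 \<Rightarrow>\<^sub>L ('g, 'h) ell2) \<le> 1"
    by (rule norm_blinfun_bound) (simp_all add: L_apply norm_L)
qed

lift_definition ell2_single :: "'g \<Rightarrow> 'h \<Rightarrow> ('g, 'h::chilbert_space) ell2"
  is "\<lambda>g x h. if h = g then x else 0"
proof -
  fix g :: 'g and x :: 'h
  show "(\<lambda>h. (norm (if h = g then x else 0))\<^sup>2) summable_on UNIV"
    using summable_on_cong_neutral[of UNIV "{g}" "\<lambda>h. (norm (if h = g then x else 0))\<^sup>2"
        "\<lambda>h. (norm (if h = g then x else 0))\<^sup>2"] by auto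
qed

lemma ell2_sum_at: "(\<And>h. h \<noteq> g \<Longrightarrow> f h = 0) \<Longrightarrow> infsum f UNIV = f g"
  for f :: "'g \<Rightarrow> 'b::{comm_monoid_add,t2_space}"
  using infsum_cong_neutral[of "{g}" UNIV f f] by auto

lemma norm_ell2_single: "norm (ell2_single g x) = norm x"
  unfolding norm_ell2.rep_eq ell2_single.rep_eq by (subst ell2_sum_at[of g]) auto

lemma cinner_ell2_single: "cinner \<xi> (ell2_single g x) = cinner (ell2_apply \<xi> g) x"
  unfolding cinner_ell2.rep_eq ell2_single.rep_eq
  by (subst ell2_sum_at[of g]) (auto simp: cinner.zero_right)


section \<open>Operators reducing a coordinate subspace\<close>

definition supported_on :: "'g set \<Rightarrow> ('g, 'h::chilbert_space) ell2 set" where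
  "supported_on A = {\<xi>. \<forall>g. g \<notin> A \<longrightarrow> ell2_apply \<xi> g = 0}"

text \<open>The commutant of the projection onto \<open>\<ell>\<^sup>2(K)\<close>.\<close>

definition block_diagonal :: "'g set \<Rightarrow> (('g, 'h::chilbert_space) ell2 \<Rightarrow>\<^sub>L ('g, 'h) ell2) set" where
  "block_diagonal K = {T \<in> cblinops. \<forall>A\<in>{K, - K}. \<forall>\<xi>\<in>supported_on A. blinfun_apply T \<xi> \<in> supported_on A}"

lemma cinner_disjoint_support:
  assumes "\<xi> \<in> supported_on A" "\<eta> \<in> supported_on (- A)"
  shows "cinner \<xi> \<eta> = 0"
  unfolding cinner_ell2.rep_eq
proof (rule infsum_0)
  fix g
  show "cinner (ell2_apply \<xi> g) (ell2_apply \<eta> g) = 0"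
    using assms by (cases "g \<in> A") (auto simp: supported_on_def cinner.zero_left cinner.zero_right)
qed

lemma supported_on_iff_orthogonal:
  "\<xi> \<in> supported_on A \<longleftrightarrow> (\<forall>\<eta>\<in>supported_on (- A). cinner \<xi> \<eta> = 0)"
proof
  assume orth: "\<forall>\<eta>\<in>supported_on (- A). cinner \<xi> \<eta> = 0"
  show "\<xi> \<in> supported_on A"
    unfolding supported_on_def
  proof safe
    fix g assume "g \<notin> A"
    then have "ell2_single g (ell2_apply \<xi> g) \<in> supported_on (- A)"
      by (auto simp: supported_on_def ell2_single.rep_eq)
    with orth have "cinner (ell2_apply \<xi> g) (ell2_apply \<xi> g) = 0"
      by (metis cinner_ell2_single)
    then show "ell2_apply \<xi> g = 0"
      by (simp add: cinner_self)
  qed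
qed (simp add: cinner_disjoint_support)

lemma block_diagonal_iff_matrix_coefficients:
  "T \<in> block_diagonal K \<longleftrightarrow> T \<in> cblinops \<and>
    (\<forall>A\<in>{K, - K}. \<forall>\<xi>\<in>supported_on A. \<forall>\<eta>\<in>supported_on (- A). cinner (blinfun_apply T \<xi>) \<eta> = 0)"
  unfolding block_diagonal_def supported_on_iff_orthogonal[of "blinfun_apply T \<xi>" for T \<xi>] by simp

text \<open>For adjoints and weak limits, invariance of the two coordinate subspaces is read
  as the vanishing of matrix coefficients between \<open>K\<close> and its complement: this is weakly closed, and it is stable under adjoints because the two sets enter symmetrically.\<close>

lemma von_neumann_algebra_block_diagonal:
  "von_neumann_algebra (block_diagonal K :: (('g, 'h::chilbert_space) ell2 \<Rightarrow>\<^sub>L ('g, 'h) ell2) set)"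
  unfolding von_neumann_algebra_def
proof (intro conjI ballI allI)
  let ?N = "block_diagonal K :: (('g, 'h) ell2 \<Rightarrow>\<^sub>L ('g, 'h) ell2) set"
  show "?N \<subseteq> cblinops"
    by (auto simp: block_diagonal_def)
  show "id_blinfun \<in> ?N"
    by (auto simp: block_diagonal_def cblinops_def)
  fix S T assume S: "S \<in> ?N" and T: "T \<in> ?N"
  show "S + T \<in> ?N"
    using S T by (auto simp: block_diagonal_def cblinops_def supported_on_def blinfun.add_left
        scaleC_add_right plus_ell2.rep_eq)
  show "S o\<^sub>L T \<in> ?N"
    using S T by (auto simp: block_diagonal_def cblinops_def)
next
  let ?N = "block_diagonal K :: (('g, 'h) ell2 \<Rightarrow>\<^sub>L ('g, 'h) ell2) set"
  fix c and T assume T: "T \<in> ?N"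
  have "c *\<^sub>C (0 :: 'h) = 0"
    using norm_scaleC[of c "0 :: 'h"] by simp
  then show "cscale_blinfun c T \<in> ?N"
    using T by (auto simp: block_diagonal_def cblinops_def supported_on_def scaleC_ell2.rep_eq
        scaleC_scaleC mult.commute)
next
  let ?N = "block_diagonal K :: (('g, 'h) ell2 \<Rightarrow>\<^sub>L ('g, 'h) ell2) set"
  fix T assume T: "T \<in> ?N"
  then have op: "T \<in> cblinops"
    by (simp add: block_diagonal_def)
  have "cinner (blinfun_apply (cadjoint T) \<xi>) \<eta> = 0"
    if "A \<in> {K, - K}" "\<xi> \<in> supported_on A" "\<eta> \<in> supported_on (- A)" for A \<xi> \<eta>
  proof -
    have "blinfun_apply T \<eta> \<in> supported_on (- A)"
      using T that by (auto simp: block_diagonal_def)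
    then show ?thesis
      using that(2) by (simp add: cinner_adjoint_left[OF op] cinner_disjoint_support)
  qed
  then show "cadjoint T \<in> ?N"
    unfolding block_diagonal_iff_matrix_coefficients using cadjoint_cblinops[OF op] by blast
next
  let ?N = "block_diagonal K :: (('g, 'h) ell2 \<Rightarrow>\<^sub>L ('g, 'h) ell2) set"
  have "?N = (\<Inter>A\<in>{K, - K}. \<Inter>\<xi>\<in>supported_on A. \<Inter>\<eta>\<in>supported_on (- A).
      {T \<in> topspace weak_operator_topology. cinner (blinfun_apply T \<xi>) \<eta> \<in> {0}})"
  proof -
    have "(0 :: ('g, 'h) ell2) \<in> supported_on A" for A
      by (simp add: supported_on_def zero_ell2.rep_eq)
    then show ?thesis
      by (auto simp: block_diagonal_iff_matrix_coefficients topspace_wot) blast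
  qed
  moreover have "supported_on A \<noteq> ({} :: ('g, 'h) ell2 set)" for A
    by (auto simp: supported_on_def zero_ell2.rep_eq intro!: exI[of _ 0])
  ultimately show "closedin weak_operator_topology ?N"
    by (simp only:) (intro closedin_INT closedin_continuous_map_preimage[OF continuous_map_wot]; simp)
qed

lemma crossed_pi_block_diagonal:
  fixes M :: "('h::chilbert_space \<Rightarrow>\<^sub>L 'h) set"
    and \<alpha> :: "'g::group_add \<Rightarrow> ('h \<Rightarrow>\<^sub>L 'h) \<Rightarrow> ('h \<Rightarrow>\<^sub>L 'h)"
  assumes M: "von_neumann_algebra M" and \<alpha>: "star_action M \<alpha>" and a: "a \<in> M"
  shows "crossed_pi \<alpha> a \<in> block_diagonal K"
proof -
  have "\<alpha> g a \<in> M" for g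
    using \<alpha> a unfolding star_action_def star_automorphism_def by (meson bij_betwE)
  then show ?thesis
    unfolding block_diagonal_def
    by (auto intro!: cblinopsI ell2_eqI simp: crossed_pi_apply[OF assms] scaleC_ell2.rep_eq
        cblinops_scaleC vna_cblinops[OF M] supported_on_def)
qed

lemma crossed_lambda_block_diagonal:
  assumes K: "is_subgroup K" and "k \<in> K"
  shows "crossed_lambda k \<in> block_diagonal K"
proof -
  have "- k + h \<in> K \<longleftrightarrow> h \<in> K" for h
  proof
    assume "- k + h \<in> K"
    then have "k + (- k + h) \<in> K"
      using assms unfolding is_subgroup_def by blast
    then show "h \<in> K"
      by (simp add: add.assoc[symmetric])
  qed (use assms in \<open>simp add: is_subgroup_def\<close>)
  then show ?thesis
    unfolding block_diagonal_def
    by (auto intro!: cblinopsI ell2_eqI simp: crossed_lambda_apply scaleC_ell2.rep_eq supported_on_def)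
qed

lemma crossed_product_block_diagonal:
  assumes "von_neumann_algebra M" and "star_action M \<alpha>" and "is_subgroup K"
  shows "crossed_product M \<alpha> K \<subseteq> block_diagonal K"
  unfolding crossed_product_def
  using assms crossed_pi_block_diagonal crossed_lambda_block_diagonal
  by (intro hull_minimal von_neumann_algebra_block_diagonal) auto

lemma crossed_lambda_in_crossed_product: "g \<in> H \<Longrightarrow> crossed_lambda g \<in> crossed_product M \<alpha> H"
  unfolding crossed_product_def by (rule subsetD[OF hull_subset]) simp

lemma zero_in_crossed_product: "0 \<in> crossed_product M \<alpha> H"
  unfolding crossed_product_def hull_def using vna_zero by auto


section \<open>Distances between crossed products\<close>

text \<open>Apply both operators to a vector \<open>x\<close> placed at the neutral element.  The translate lives at \<open>g\<close>,
  whereas the block-diagonal operator keeps it in \<open>\<ell>\<^sup>2(K)\<close>, which does not see the coordinate \<open>g\<close>.\<close>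

lemma norm_crossed_lambda_diff_ge_1:
  fixes T :: "('g::group_add, 'h::chilbert_space) ell2 \<Rightarrow>\<^sub>L ('g, 'h) ell2" and x :: 'h
  assumes T: "T \<in> block_diagonal K" and "0 \<in> K" "g \<notin> K" and "x \<noteq> 0"
  shows "1 \<le> norm (crossed_lambda g - T)"
proof -
  let ?\<xi> = "ell2_single 0 x :: ('g, 'h) ell2"
  have "?\<xi> \<in> supported_on K"
    using \<open>0 \<in> K\<close> by (auto simp: supported_on_def ell2_single.rep_eq)
  then have "ell2_apply (blinfun_apply T ?\<xi>) g = 0"
    using T \<open>g \<notin> K\<close> by (auto simp: block_diagonal_def supported_on_def)
  then have "ell2_apply (blinfun_apply (crossed_lambda g - T) ?\<xi>) g = x"
    by (simp add: blinfun.diff_left minus_ell2.rep_eq crossed_lambda_apply ell2_single.rep_eq)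
  then have "norm x \<le> norm (blinfun_apply (crossed_lambda g - T) ?\<xi>)"
    by (metis norm_ell2_apply_le)
  also have "\<dots> \<le> norm (crossed_lambda g - T) * norm x"
    by (metis norm_blinfun norm_ell2_single)
  finally show ?thesis
    using \<open>x \<noteq> 0\<close> by simp
qed

text \<open>Both distances are at most \<open>1\<close> because \<open>0\<close> approximates every contraction within \<open>1\<close>, and one
  contraction at distance at least \<open>1\<close> from the other space forces equality.\<close>

lemma distances_eq_1:
  fixes Y Z :: "'v::real_normed_vector set"
  assumes zero: "0 \<in> Y" "0 \<in> Z" and y: "y \<in> Y" "norm y \<le> 1"
    and far: "\<And>z. z \<in> Z \<Longrightarrow> 1 \<le> norm (y - z)"
  shows "kadison_kastler_dist Y Z = 1" and "christensen_dist Y Z = 1"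
proof -
  have inf_le: "infdist u (W \<inter> cball 0 1) \<le> 1" if "u \<in> V \<inter> cball 0 1" "0 \<in> W" for u :: 'v and V W
    using that infdist_le[of 0 "W \<inter> cball 0 1" u] by simp
  have Sup_le: "(SUP u\<in>V \<inter> cball 0 1. infdist u (W \<inter> cball 0 1)) \<le> 1"
    if "0 \<in> V" "0 \<in> W" for V W :: "'v set"
    using that by (intro cSUP_least inf_le) auto
  have "1 \<le> infdist y (Z \<inter> cball 0 1)"
    using zero(2) far by (subst infdist_notempty) (auto intro!: cINF_greatest simp: dist_norm)
  also have "\<dots> \<le> (SUP y\<in>Y \<inter> cball 0 1. infdist y (Z \<inter> cball 0 1))"
    using y zero(2) by (intro cSUP_upper bdd_aboveI2[where M = 1] inf_le) auto
  finally show "kadison_kastler_dist Y Z = 1"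
    unfolding kadison_kastler_dist_def using Sup_le[of Y Z] Sup_le[of Z Y] zero by linarith
  let ?\<Gamma> = "{\<gamma>. 0 < \<gamma> \<and> near_contained \<gamma> Y Z \<and> near_contained \<gamma> Z Y}"
  have "1 \<in> ?\<Gamma>"
    using zero by (auto simp: near_contained_def intro!: bexI[of _ 0])
  moreover have "1 \<le> \<gamma>" if \<gamma>: "\<gamma> \<in> ?\<Gamma>" for \<gamma>
  proof -
    have "y \<in> Y \<inter> cball 0 1"
      using y by simp
    then obtain z where "z \<in> Z" "norm (y - z) \<le> \<gamma>"
      using \<gamma> unfolding near_contained_def by blast
    then show ?thesis
      using far[of z] by linarith
  qed
  ultimately show "christensen_dist Y Z = 1"
    unfolding christensen_dist_def by (intro cInf_eq_minimum)
qed

lemma distances_commute: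
  "kadison_kastler_dist Y Z = kadison_kastler_dist Z Y" "christensen_dist Y Z = christensen_dist Z Y"
  by (simp_all add: kadison_kastler_dist_def christensen_dist_def max.commute conj_commute)

lemma crossed_product_distances_eq_1:
  fixes M :: "('h::chilbert_space \<Rightarrow>\<^sub>L 'h) set"
    and \<alpha> :: "'g::group_add \<Rightarrow> ('h \<Rightarrow>\<^sub>L 'h) \<Rightarrow> ('h \<Rightarrow>\<^sub>L 'h)"
  assumes M: "von_neumann_algebra M" "M \<noteq> {0}" and \<alpha>: "star_action M \<alpha>"
    and K: "is_subgroup K" and g: "g \<in> H" "g \<notin> K"
  shows "kadison_kastler_dist (crossed_product M \<alpha> H) (crossed_product M \<alpha> K) = 1"
    and "christensen_dist (crossed_product M \<alpha> H) (crossed_product M \<alpha> K) = 1"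
proof -
  obtain T where "T \<in> M" "T \<noteq> 0"
    using M vna_zero[OF M(1)] by blast
  then obtain x :: 'h where "x \<noteq> 0"
    by (metis blinfun_eqI blinfun.zero_left blinfun.zero_right)
  have far: "1 \<le> norm (crossed_lambda g - T)" if "T \<in> crossed_product M \<alpha> K" for T
  proof (rule norm_crossed_lambda_diff_ge_1[OF _ _ g(2) \<open>x \<noteq> 0\<close>])
    show "T \<in> block_diagonal K"
      using that crossed_product_block_diagonal[OF M(1) \<alpha> K] by blast
    show "0 \<in> K"
      using K by (simp add: is_subgroup_def)
  qed
  show "kadison_kastler_dist (crossed_product M \<alpha> H) (crossed_product M \<alpha> K) = 1"
    and "christensen_dist (crossed_product M \<alpha> H) (crossed_product M \<alpha> K) = 1"
    using distances_eq_1[OF zero_in_crossed_product zero_in_crossed_product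
        crossed_lambda_in_crossed_product[OF g(1)] norm_crossed_lambda_le far] by blast+
qed

theorem theorem5p9:
  fixes M :: "('h::chilbert_space \<Rightarrow>\<^sub>L 'h) set"
    and \<alpha> :: "'g::group_add \<Rightarrow> ('h \<Rightarrow>\<^sub>L 'h) \<Rightarrow> ('h \<Rightarrow>\<^sub>L 'h)"
    and H K :: "'g set"
  assumes "von_neumann_algebra M" and "M \<noteq> {0}"
    and "star_action M \<alpha>"
    and "is_subgroup H" and "is_subgroup K" and "H \<noteq> K"
  shows "kadison_kastler_dist (crossed_product M \<alpha> H) (crossed_product M \<alpha> K) = 1
    \<and> christensen_dist (crossed_product M \<alpha> H) (crossed_product M \<alpha> K) = 1"
proof -
  consider g where "g \<in> H" "g \<notin> K" | g where "g \<in> K" "g \<notin> H"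
    using \<open>H \<noteq> K\<close> by blast
  then show ?thesis
  proof cases
    case 1
    then show ?thesis
      using crossed_product_distances_eq_1 assms by blast
  next
    case 2
    then have "kadison_kastler_dist (crossed_product M \<alpha> K) (crossed_product M \<alpha> H) = 1"
      and "christensen_dist (crossed_product M \<alpha> K) (crossed_product M \<alpha> H) = 1"
      using crossed_product_distances_eq_1 assms by blast+
    then show ?thesis
      by (simp add: distances_commute)
  qed
qed

end
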